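(* For all integers $j,k\ge 1$ and $m\ge 0$, \[ w_{2k+j,k,m}=\frac{1}{j}\binom{2k+j}{k-1}N^{(j-1)}_{k+j-1,m},\] and for all integers $1\le j\le k$ and $m\ge 0$, \[ w_{2k-j,k,m}=\frac{1}{j}\binom{2k-j}{k-1}N^{(j-1)}_{k-1,m}.\]
   Context: A Dyck path of semilength $n$ is a word in the letters $U,D$ with $n$ copies of each letter such that no prefix contains more $D$'s than $U$'s. A $UD$-factor (resp. $UUD$-factor) is an occurrence of $UD$ (resp. $UUD$) as a consecutive subword. $w_{n,k,m}$ denotes the number of Dyck paths of semilength $n$ with exactly $k$ $UD$-factors and exactly $m$ $UUD$-factors. For $0\le r\le n$ and $0\le i\le n-r$, the $r$-generalized Narayana number is $N^{(r)}_{n,i}=\frac{r+1}{n+1}\binom{n+1}{i}\binom{n-r-1}{i-1}$, with the convention that $\binom{a}{b}=0$ for $b<0$ except $\binom{-1}{-1}=1$; for $i>n-r$ we take $N^{(r)}_{n,i}=0$. *)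

theory Defs
  imports Complex_Main "HOL-Library.Sublist"
begin

datatype step = U | D

definition dyck_path :: "nat \<Rightarrow> step list \<Rightarrow> bool" where
  "dyck_path n w \<longleftrightarrow>
     count_list w U = n \<and> count_list w D = n \<and>
     (\<forall>p. prefix p w \<longrightarrow> count_list p D \<le> count_list p U)"

(* Occurrences are counted by their starting position, so overlapping ones count separately. *)
definition num_factors :: "'a list \<Rightarrow> 'a list \<Rightarrow> nat" where
  "num_factors u w =
     card {i. i + length u \<le> length w \<and> take (length u) (drop i w) = u}"

definition dyck_count :: "nat \<Rightarrow> nat \<Rightarrow> nat \<Rightarrow> nat" where
  "dyck_count n k m =
     card {w. dyck_path n w \<and> num_factors [U, D] w = k \<and> num_factors [U, U, D] w = m}"

(* Binomial coefficient with integer arguments; for b < 0 it vanishes, except at (-1, -1). *)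
definition binom :: "int \<Rightarrow> int \<Rightarrow> real" where
  "binom a b =
     (if b < 0 then (if a = -1 \<and> b = -1 then 1 else 0)
      else of_int a gchoose nat b)"

(* The numbers are defined for r \<le> n and extended by 0 for i > n - r; the value 0 for
   r > n is arbitrary.  The second binomial is taken over the integers because its upper
   argument is -1 when r = n and its lower argument is -1 when i = 0. *)
definition gen_narayana :: "nat \<Rightarrow> nat \<Rightarrow> nat \<Rightarrow> real" where
  "gen_narayana r n i =
     (if r \<le> n \<and> i \<le> n - r
      then (real r + 1) / (real n + 1) * binom (int n + 1) (int i)
             * binom (int n - int r - 1) (int i - 1)
      else 0)"

end

theory Submission
  imports Defs
begin

text \<open>
  A nonempty Dyck path is a sequence of blocks \<open>U\<^sup>a\<^sup>+\<^sup>1 D\<^sup>b\<^sup>+\<^sup>1\<close>: its \<open>UD\<close>-factors are the blocks,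
  its \<open>UUD\<close>-factors the blocks with \<open>a > 0\<close>. Lengthening the last descent by one step turns it
  into a sequence of \<open>k\<close> blocks of total height \<open>-1\<close> all of whose proper prefixes have
  nonnegative height. By the cycle lemma, exactly one of the \<open>k\<close> rotations of any block sequence
  of total height \<open>-1\<close> has this form. Ascents and descents of the latter can be chosen
  independently, so that \<open>k w\<^sub>n\<^sub>,\<^sub>k\<^sub>,\<^sub>m\<close> is a product of two numbers of compositions.
\<close>

section \<open>The cycle lemma\<close>

text \<open>Weight and starting height are parameters: the same predicate then serves single steps
  and whole blocks, and a word can be split at any point.\<close>

definition nonneg_prefixes :: "('a \<Rightarrow> int) \<Rightarrow> int \<Rightarrow> 'a list \<Rightarrow> bool" where
  "nonneg_prefixes v h xs \<longleftrightarrow> (\<forall>p. prefix p xs \<longrightarrow> 0 \<le> h + sum_list (map v p))"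

lemma nonneg_prefixes_Nil [simp]: "nonneg_prefixes v h [] \<longleftrightarrow> 0 \<le> h"
  by (auto simp: nonneg_prefixes_def)

lemma nonneg_prefixes_Cons [simp]:
  "nonneg_prefixes v h (x # xs) \<longleftrightarrow> 0 \<le> h \<and> nonneg_prefixes v (h + v x) xs"
  by (auto simp: nonneg_prefixes_def prefix_Cons add.assoc)

lemma nonneg_prefixes_start: "nonneg_prefixes v h xs \<Longrightarrow> 0 \<le> h"
  by (cases xs) auto

lemma nonneg_prefixes_append:
  "nonneg_prefixes v h (xs @ ys) \<longleftrightarrow>
     nonneg_prefixes v h xs \<and> nonneg_prefixes v (h + sum_list (map v xs)) ys"
  by (induction xs arbitrary: h) (auto simp: add.assoc dest: nonneg_prefixes_start)

lemma nonneg_prefixes_final: "nonneg_prefixes v h xs \<Longrightarrow> 0 \<le> h + sum_list (map v xs)"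
  by (simp add: nonneg_prefixes_def)

lemma nonneg_prefixes_take:
  "nonneg_prefixes v h xs \<longleftrightarrow> (\<forall>i\<le>length xs. 0 \<le> h + sum_list (map v (take i xs)))"
  unfolding nonneg_prefixes_def
  by (metis append_eq_conv_conj nle_le prefix_def take_all take_is_prefix)

text \<open>A nontrivial rotation cuts \<open>xs\<close> into \<open>u @ w\<close>. Then
  \<open>u\<close> is a proper prefix of \<open>xs\<close> and \<open>w\<close> one of the rotation,
  so both sums are nonnegative, against a total of -1.\<close>

lemma good_rotation_trivial:
  assumes sum: "sum_list (map v xs) = -1"
    and good: "nonneg_prefixes v 0 (butlast xs)" "nonneg_prefixes v 0 (butlast (rotate i xs))"
  shows "i mod length xs = 0"
proof (rule ccontr)
  define j where "j = i mod length xs"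
  assume "i mod length xs \<noteq> 0"
  moreover have "xs \<noteq> []" using sum by auto
  ultimately have j: "0 < j" "j < length xs" by (auto simp: j_def)
  define u where "u = take j xs"
  define w where "w = drop j xs"
  have ne: "u \<noteq> []" "w \<noteq> []" using j by (auto simp: u_def w_def)
  have xs: "xs = u @ w" by (simp add: u_def w_def)
  have rot: "rotate i xs = w @ u"
    by (simp add: rotate_drop_take j_def u_def w_def)
  have "0 \<le> sum_list (map v u)"
    using good(1) ne unfolding xs
    by (auto simp: butlast_append nonneg_prefixes_append dest: nonneg_prefixes_final)
  moreover have "0 \<le> sum_list (map v w)"
    using good(2) ne unfolding rot
    by (auto simp: butlast_append nonneg_prefixes_append dest: nonneg_prefixes_final)
  ultimately show False using sum xs by simp
qed

lemma good_rotation_exists: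
  assumes sum: "sum_list (map v xs) = -1"
  obtains i where "i < length xs" "nonneg_prefixes v 0 (butlast (rotate i xs))"
proof -
  define s where "s i = sum_list (map v (take i xs))" for i
  define k where "k = length xs"
  have k: "0 < k" using sum by (cases xs) (auto simp: k_def)
  have sk: "s k = -1" using sum by (simp add: s_def k_def)
  \<comment> \<open>Start the rotation where the prefix sums attain their minimum for the first time.\<close>
  define M where "M = Min (s ` {..k})"
  have M: "\<And>l. l \<le> k \<Longrightarrow> M \<le> s l" by (simp add: M_def)
  have "M \<in> s ` {..k}" unfolding M_def by (intro Min_in) auto
  then have ex: "\<exists>i. i \<le> k \<and> s i = M" by auto
  define i where "i = (LEAST i. i \<le> k \<and> s i = M)"
  have i: "i \<le> k" "s i = M" using LeastI_ex[OF ex] by (auto simp: i_def)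
  have before: "M < s l" if "l < i" for l
  proof -
    have "s l \<noteq> M" using not_less_Least[of l "\<lambda>i. i \<le> k \<and> s i = M"] that i by (auto simp: i_def)
    with M[of l] that i show ?thesis by force
  qed
  have "rotate i xs = drop i xs @ take i xs"
  proof (cases "i = k")
    case True then show ?thesis by (simp add: k_def)
  next
    case False then show ?thesis using i by (simp add: rotate_drop_take k_def)
  qed
  moreover have ge: "nonneg_prefixes v 0 (drop i xs)"
    unfolding nonneg_prefixes_take
  proof (intro allI impI)
    fix l assume "l \<le> length (drop i xs)"
    then have "M \<le> s (i + l)" using i by (intro M) (simp add: k_def)
    also have "s (i + l) = s i + sum_list (map v (take l (drop i xs)))"
      by (simp add: s_def take_add)
    finally show "0 \<le> 0 + sum_list (map v (take l (drop i xs)))" using i by simp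
  qed
  moreover have "s k = s i + sum_list (map v (drop i xs))"
    by (simp add: s_def k_def flip: sum_list_append map_append)
  then have rest: "sum_list (map v (drop i xs)) = -1 - M" using sk i by simp
  \<comment> \<open>\<open>-1 - M\<close> is the height reached after \<open>drop i xs\<close>. As
    \<open>i\<close> is the first minimum, earlier prefix sums are at least \<open>M + 1\<close>,
    which compensates exactly.\<close>
  have "nonneg_prefixes v (-1 - M) (butlast (take i xs))" if "i \<noteq> 0"
    unfolding nonneg_prefixes_take
  proof (intro allI impI)
    fix l assume "l \<le> length (butlast (take i xs))"
    then have "l \<le> i - 1" "l < i" using i that by (auto simp: k_def)
    with before[of l] i show "0 \<le> -1 - M + sum_list (map v (take l (butlast (take i xs))))"
      by (simp add: s_def k_def butlast_take min_def)
  qed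
  moreover have "nonneg_prefixes v 0 (butlast (drop i xs))"
    using ge by (cases "drop i xs" rule: rev_cases) (auto simp: nonneg_prefixes_append)
  ultimately have *: "nonneg_prefixes v 0 (butlast (rotate i xs))"
    using rest by (cases "take i xs = []") (auto simp: butlast_append nonneg_prefixes_append)
  \<comment> \<open>The first minimum may lie at \<open>i = k\<close>, outside the required
    range.\<close>
  have "rotate (i mod k) xs = rotate i xs" by (simp add: k_def flip: rotate_conv_mod)
  with * that[of "i mod k"] k show ?thesis by (simp add: k_def)
qed

text \<open>Each member of \<open>S\<close> is a rotation of a good one in exactly one way. Allowing
  any rotation-closed \<open>S\<close> leaves room for further invariants, such as the number of
  nonzero entries.\<close>

theorem cycle_lemma:
  assumes S: "\<And>xs. xs \<in> S \<Longrightarrow> length xs = k \<and> sum_list (map v xs) = -1"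
    and rot: "\<And>xs i. xs \<in> S \<Longrightarrow> rotate i xs \<in> S"
  shows "card S = k * card {xs \<in> S. nonneg_prefixes v 0 (butlast xs)}"
proof -
  let ?G = "{xs \<in> S. nonneg_prefixes v 0 (butlast xs)}"
  have "bij_betw (\<lambda>(i, xs). rotate i xs) ({..<k} \<times> ?G) S"
  proof (rule bij_betw_imageI)
    have "i = i' \<and> xs = ys"
      if "i < k" "i' < k" "xs \<in> ?G" "ys \<in> ?G" and eq: "rotate i xs = rotate i' ys" for i i' xs ys
    proof -
      have len: "length xs = k" "length ys = k" using S that by auto
      \<comment> \<open>Undoing the rotation shows \<open>xs\<close> as a rotation of
        \<open>ys\<close>. Both are good, so \<open>k\<close> divides \<open>k - i + i'\<close>,
        which lies strictly between 0 and \<open>2 * k\<close>.\<close>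
      have "xs = rotate (k - i) (rotate i xs)" using that(1) len by (simp add: rotate_rotate)
      also have "\<dots> = rotate (k - i + i') ys" by (simp add: eq rotate_rotate)
      finally have xs: "xs = rotate (k - i + i') ys" .
      then have "(k - i + i') mod k = 0"
        using good_rotation_trivial[of v ys "k - i + i'"] that S len by auto
      then have dvd: "k dvd k - i + i'" by presburger
      have "i' = i"
      proof -
        from dvd obtain q where q: "k - i + i' = k * q" by auto
        moreover have "0 < k * q" using q that by linarith
        moreover have "k * q < k * 2" using q that by linarith
        ultimately have "q = 1" by simp
        then show ?thesis using q that by simp
      qed
      moreover have "xs = ys"
        using xs len \<open>(k - i + i') mod k = 0\<close> by (metis rotate_conv_mod rotate0 id_apply)
      ultimately show ?thesis by simp
    qed
    then show "inj_on (\<lambda>(i, xs). rotate i xs) ({..<k} \<times> ?G)"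
      by (auto simp: inj_on_def)
    show "(\<lambda>(i, xs). rotate i xs) ` ({..<k} \<times> ?G) = S"
    proof (intro equalityI subsetI)
      fix xs assume xs: "xs \<in> S"
      then obtain i where i: "i < k" "nonneg_prefixes v 0 (butlast (rotate i xs))"
        using good_rotation_exists[of v xs] S by metis
      \<comment> \<open>The reduction modulo \<open>k\<close> matters for \<open>i = 0\<close>,
        where \<open>k - i\<close> is out of range.\<close>
      have "rotate ((k - i) mod k) (rotate i xs) = xs"
        using S[OF xs] i by (metis rotate_conv_mod length_rotate rotate_rotate rotate_id
            le_add_diff_inverse2 less_imp_le mod_self id_apply)
      moreover have "(k - i) mod k < k" "rotate i xs \<in> ?G" using i rot[OF xs] by auto
      ultimately show "xs \<in> (\<lambda>(i, xs). rotate i xs) ` ({..<k} \<times> ?G)"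
        by (intro image_eqI[of _ _ "((k - i) mod k, rotate i xs)"]) auto
    qed (use rot in auto)
  qed
  then have "card ({..<k} \<times> ?G) = card S" by (rule bij_betw_same_card)
  then show ?thesis by (simp add: card_cartesian_product)
qed

section \<open>Block decomposition of words\<close>

lemma num_factors_Nil: "u \<noteq> [] \<Longrightarrow> num_factors u [] = 0"
  by (auto simp: num_factors_def)

lemma num_factors_Cons:
  "num_factors u (x # w) = (if prefix u (x # w) then 1 else 0) + num_factors u w"
proof -
  let ?A = "\<lambda>w. {i. i + length u \<le> length w \<and> take (length u) (drop i w) = u}"
  have "?A (x # w) = (if prefix u (x # w) then {0} else {}) \<union> Suc ` ?A w"
  proof (intro set_eqI)
    fix i
    have "prefix u (x # w) \<longleftrightarrow> length u \<le> Suc (length w) \<and> take (length u) (x # w) = u"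
      by (metis length_Cons prefix_length_le append_eq_conv_conj prefix_def take_is_prefix)
    then show "i \<in> ?A (x # w) \<longleftrightarrow> i \<in> (if prefix u (x # w) then {0} else {}) \<union> Suc ` ?A w"
      by (cases i) (auto simp: image_iff)
  qed
  moreover have "finite (?A w)" by (rule finite_subset[of _ "{..length w}"]) auto
  ultimately show ?thesis
    unfolding num_factors_def
    by (subst \<open>?A (x # w) = _\<close>, subst card_Un_disjoint) (auto simp: card_image)
qed

text \<open>Storing run lengths minus one makes every pair a legal block, so lists of pairs carry no
  side condition.\<close>

definition block :: "nat \<times> nat \<Rightarrow> step list" where
  "block p = replicate (Suc (fst p)) U @ replicate (Suc (snd p)) D"

abbreviation blocks :: "(nat \<times> nat) list \<Rightarrow> step list" where
  "blocks ps \<equiv> concat (map block ps)"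

fun step_height :: "step \<Rightarrow> int" where
  "step_height U = 1"
| "step_height D = -1"

definition block_height :: "nat \<times> nat \<Rightarrow> int" where
  "block_height p = int (fst p) - int (snd p)"

lemma sum_list_step_height:
  "sum_list (map step_height w) = int (count_list w U) - int (count_list w D)"
proof (induction w)
  case (Cons x w) then show ?case by (cases x) auto
qed simp

lemma sum_list_block_height:
  "sum_list (map block_height ps) = int (sum_list (map fst ps)) - int (sum_list (map snd ps))"
  by (induction ps) (auto simp: block_height_def)

lemma dyck_path_iff:
  "dyck_path n w \<longleftrightarrow>
     count_list w U = n \<and> count_list w D = n \<and> nonneg_prefixes step_height 0 w"
  by (simp add: dyck_path_def nonneg_prefixes_def sum_list_step_height)

lemma count_list_replicate: "count_list (replicate n x) y = (if x = y then n else 0)"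
  by (induction n) auto

lemma count_list_blocks:
  "count_list (blocks ps) U = sum_list (map fst ps) + length ps"
  "count_list (blocks ps) D = sum_list (map snd ps) + length ps"
  by (induction ps) (auto simp: block_def count_list_replicate)

text \<open>No occurrence starts in a descent, and one starting in the ascent must end at the first
  \<open>D\<close>; hence what follows the block does not matter.\<close>

lemma num_factors_UD_block: "num_factors [U, D] (block p @ w) = Suc (num_factors [U, D] w)"
proof -
  have "num_factors [U, D] (replicate b D @ w) = num_factors [U, D] w" for b w
    by (induction b) (auto simp: num_factors_Cons)
  moreover have "num_factors [U, D] (replicate (Suc a) U @ D # w) = Suc (num_factors [U, D] w)"
    for a w by (induction a) (auto simp: num_factors_Cons)
  ultimately show ?thesis by (simp add: block_def)
qed

lemma num_factors_UUD_block:
  "num_factors [U, U, D] (block p @ w) =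
     (if 0 < fst p then 1 else 0) + num_factors [U, U, D] w"
proof -
  have "num_factors [U, U, D] (replicate b D @ w) = num_factors [U, U, D] w" for b w
    by (induction b) (auto simp: num_factors_Cons)
  moreover have "num_factors [U, U, D] (replicate (Suc a) U @ D # w) =
      (if 0 < a then 1 else 0) + num_factors [U, U, D] w" for a w
  proof (induction a)
    case (Suc a) then show ?case by (cases a) (auto simp: num_factors_Cons)
  qed (simp add: num_factors_Cons)
  ultimately show ?thesis by (simp add: block_def)
qed

lemma num_factors_UD_blocks: "num_factors [U, D] (blocks ps) = length ps"
  by (induction ps) (auto simp: num_factors_Nil num_factors_UD_block)

lemma num_factors_UUD_blocks:
  "num_factors [U, U, D] (blocks ps) = length (filter ((<) 0) (map fst ps))"
  by (induction ps) (auto simp: num_factors_Nil num_factors_UUD_block)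

lemma nonneg_prefixes_replicate_U:
  "nonneg_prefixes step_height h (replicate a U) \<longleftrightarrow> 0 \<le> h"
proof (induction a arbitrary: h)
  case (Suc a)
  then show ?case by simp linarith
qed simp

lemma nonneg_prefixes_replicate_D:
  "nonneg_prefixes step_height h (replicate b D) \<longleftrightarrow> int b \<le> h"
  by (induction b arbitrary: h) auto

text \<open>Within a block the path first rises and then falls, so its lowest points are the two
  ends.\<close>

lemma nonneg_prefixes_blocks:
  "nonneg_prefixes step_height h (blocks ps) \<longleftrightarrow> nonneg_prefixes block_height h ps"
proof (induction ps arbitrary: h)
  case (Cons p ps)
  have "nonneg_prefixes step_height h (blocks (p # ps)) \<longleftrightarrow>
      0 \<le> h \<and> 0 \<le> h + block_height p \<and> nonneg_prefixes block_height (h + block_height p) ps"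
    unfolding Cons.IH[symmetric]
    by (auto simp: block_def block_height_def nonneg_prefixes_append sum_list_replicate
        nonneg_prefixes_replicate_U nonneg_prefixes_replicate_D algebra_simps
        simp del: replicate_Suc)
  then show ?case by (auto dest: nonneg_prefixes_start)
qed simp

text \<open>The first two runs of the word give the first block: the remaining word is empty or
  starts with \<open>U\<close>, so it cannot prolong the descent.\<close>

lemma blocks_inj: "blocks ps = blocks qs \<Longrightarrow> ps = qs"
proof (induction ps arbitrary: qs)
  case Nil then show ?case by (cases qs) (auto simp: block_def)
next
  case (Cons p ps)
  have D: "takeWhile ((=) D) (blocks rs) = []" "dropWhile ((=) D) (blocks rs) = blocks rs" for rs
    by (cases rs; simp add: block_def)+
  have decode:
    "length (takeWhile ((=) U) (blocks (r # rs))) = Suc (fst r)"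
    "length (takeWhile ((=) D) (dropWhile ((=) U) (blocks (r # rs)))) = Suc (snd r)"
    "dropWhile ((=) D) (dropWhile ((=) U) (blocks (r # rs))) = blocks rs" for r rs
    by (auto simp: block_def takeWhile_append dropWhile_append D simp del: replicate_Suc)
  from Cons.prems obtain q qs' where qs: "qs = q # qs'"
    by (cases qs) (auto simp: block_def)
  have "fst p = fst q" "snd p = snd q" "blocks ps = blocks qs'"
    using decode[of p ps] decode[of q qs'] Cons.prems unfolding qs by (metis nat.inject)+
  then show ?case using Cons.IH qs by (simp add: prod_eq_iff)
qed

text \<open>The run of \<open>D\<close>s is what lets the induction pass to suffixes, which may
  begin inside a descent. A new \<open>U\<close> either turns this run into the descent of a new
  block or, if the run is empty, lengthens the first ascent.\<close>

lemma ends_in_D_decomposition: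
  "(w \<noteq> [] \<Longrightarrow> last w = D) \<Longrightarrow> \<exists>b ps. w = replicate b D @ blocks ps"
proof (induction w)
  case Nil
  show ?case by (intro exI[of _ 0] exI[of _ "[]"]) simp
next
  case (Cons x w)
  have "w \<noteq> [] \<Longrightarrow> last w = D" using Cons.prems by simp
  from Cons.IH[OF this] obtain b ps where w: "w = replicate b D @ blocks ps" by blast
  consider "x = D" | "x = U" "b = 0" | b' where "x = U" "b = Suc b'"
    by (cases x; cases b) auto
  then show ?case
  proof cases
    case 1
    with w show ?thesis by (intro exI[of _ "Suc b"] exI[of _ ps]) simp
  next
    case 2
    \<comment> \<open>With \<open>ps\<close> empty the word would be the single letter
      \<open>U\<close>, which does not end in \<open>D\<close>.\<close>
    with w Cons.prems obtain p qs where "ps = p # qs"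
      by (cases ps) auto
    with w 2 show ?thesis
      by (intro exI[of _ 0] exI[of _ "(Suc (fst p), snd p) # qs"])
        (simp add: block_def[of p] block_def[of "(_, _)"])
  next
    case 3
    with w show ?thesis
      by (intro exI[of _ 0] exI[of _ "(0, b') # ps"])
        (simp add: block_def[of "(_, _)"])
  qed
qed

text \<open>A final \<open>U\<close> would be preceded by height -1, and a leading \<open>D\<close>
  would reach height -1.\<close>

lemma dyck_path_blocks:
  assumes "dyck_path n w"
  obtains ps where "w = blocks ps"
proof -
  have "last w = D" if "w \<noteq> []"
  proof (cases "last w")
    case U
    with that obtain w' where "w = w' @ [U]" by (metis append_butlast_last_id)
    with assms show ?thesis
      by (auto simp: dyck_path_iff nonneg_prefixes_append sum_list_step_height)
  qed
  then obtain b ps where w: "w = replicate b D @ blocks ps" using ends_in_D_decomposition by blast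
  with assms have "b = 0"
    by (auto simp: dyck_path_iff nonneg_prefixes_append nonneg_prefixes_replicate_D)
  with w that show ?thesis by simp
qed

lemma dyck_count_eq_card_blocks:
  "dyck_count n k m =
     card {ps. length ps = k \<and> sum_list (map fst ps) + k = n \<and> sum_list (map snd ps) + k = n \<and>
       length (filter ((<) 0) (map fst ps)) = m \<and> nonneg_prefixes block_height 0 ps}"
    (is "_ = card ?P")
proof -
  have "{w. dyck_path n w \<and> num_factors [U, D] w = k \<and> num_factors [U, U, D] w = m} = blocks ` ?P"
    (is "?W = _")
  proof (intro equalityI subsetI)
    fix w assume w: "w \<in> ?W"
    then obtain ps where ps: "w = blocks ps" using dyck_path_blocks by blast
    with w have "ps \<in> ?P"
      by (simp add: dyck_path_iff count_list_blocks num_factors_UD_blocks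
          num_factors_UUD_blocks nonneg_prefixes_blocks)
    with ps show "w \<in> blocks ` ?P" by blast
  next
    fix w assume "w \<in> blocks ` ?P"
    then show "w \<in> ?W"
      by (auto simp: dyck_path_iff count_list_blocks num_factors_UD_blocks
          num_factors_UUD_blocks nonneg_prefixes_blocks)
  qed
  moreover have "inj_on blocks ?P" by (auto simp: inj_on_def dest: blocks_inj)
  ultimately show ?thesis by (simp add: dyck_count_def card_image)
qed

section \<open>Counting\<close>

text \<open>The number of compositions of \<open>N\<close> into \<open>m\<close> positive parts.\<close>
fun compositions :: "nat \<Rightarrow> nat \<Rightarrow> nat" where
  "compositions 0 m = (if m = 0 then 1 else 0)"
| "compositions (Suc N) 0 = 0"
| "compositions (Suc N) (Suc m) = N choose m"

text \<open>Split off one part \<open>N - j\<close>. In the induction step, Pascal's rule reads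
  \<open>compositions (Suc N) (Suc m) = compositions N (Suc m) + compositions N m\<close>.\<close>

lemma sum_compositions: "(\<Sum>j<N. compositions j m) = compositions N (Suc m)"
proof (induction N)
  case (Suc N)
  then show ?case by (cases N; cases m) auto
qed simp

lemma finite_lists_sum: "finite {xs::nat list. length xs = k \<and> sum_list xs = N \<and> P xs}"
  by (rule finite_subset[OF _ finite_lists_length_eq[of "{..N}" k]])
    (auto intro: member_le_sum_list)

text \<open>Choose the positions of the \<open>m\<close> nonzero entries; these entries form a
  composition of \<open>N\<close>. The induction removes the first entry.\<close>

lemma card_lists_sum_positive:
  "card {xs. length xs = k \<and> sum_list xs = N \<and> length (filter ((<) 0) xs) = m} =
     (k choose m) * compositions N m"
proof (induction k arbitrary: N m)
  case 0
  have "{xs. length xs = 0 \<and> sum_list xs = N \<and> length (filter ((<) 0) xs) = m} =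
      (if N = 0 \<and> m = 0 then {[]} else {})" by auto
  then show ?case by (cases N; cases m) auto
next
  case (Suc k)
  let ?A = "\<lambda>k N m. {xs::nat list. length xs = k \<and> sum_list xs = N \<and> length (filter ((<) 0) xs) = m}"
  have fin: "finite (?A k N m)" for N m by (rule finite_lists_sum)
  show ?case
  proof (cases m)
    case 0
    have "?A (Suc k) N m = Cons 0 ` ?A k N m"
      by (auto simp: 0 length_Suc_conv image_iff split: if_splits)
    then have "card (?A (Suc k) N m) = card (?A k N m)" by (simp add: card_image)
    then show ?thesis by (simp only: Suc.IH) (simp add: 0)
  next
    case (Suc m')
    \<comment> \<open>A positive first entry is indexed by the sum \<open>j < N\<close> of the other
      entries.\<close>
    have split: "?A (Suc k) N m =
        Cons 0 ` ?A k N m \<union> (\<Union>j\<in>{..<N}. Cons (N - j) ` ?A k j m')" (is "_ = ?R")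
    proof (intro equalityI subsetI)
      fix xs assume xs: "xs \<in> ?A (Suc k) N m"
      then obtain x ys where [simp]: "xs = x # ys" by (auto simp: length_Suc_conv)
      show "xs \<in> ?R"
      proof (cases x)
        case 0 then show ?thesis using xs by (auto simp: image_iff)
      next
        case (Suc y)
        then have "xs \<in> Cons (N - sum_list ys) ` ?A k (sum_list ys) m'" "sum_list ys < N"
          using xs \<open>m = Suc m'\<close> by (auto simp: image_iff)
        then show ?thesis by blast
      qed
    next
      fix xs assume "xs \<in> ?R"
      then consider ys where "xs = 0 # ys" "ys \<in> ?A k N m"
        | j ys where "j < N" "xs = (N - j) # ys" "ys \<in> ?A k j m'" by blast
      then show "xs \<in> ?A (Suc k) N m"
        by cases (simp_all add: Suc)
    qed
    have "card (?A (Suc k) N m) = card (Cons 0 ` ?A k N m) +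
        card (\<Union>j\<in>{..<N}. Cons (N - j) ` ?A k j m')"
      unfolding split using fin by (intro card_Un_disjoint) auto
    also have "card (\<Union>j\<in>{..<N}. Cons (N - j) ` ?A k j m') =
        (\<Sum>j<N. card (Cons (N - j) ` ?A k j m'))"
      using fin by (intro card_UN_disjoint) auto
    also have "\<dots> = (k choose m') * compositions N m"
      by (simp add: card_image Suc.IH Suc sum_compositions flip: sum_distrib_left)
    finally show ?thesis
      by (simp add: card_image Suc.IH Suc algebra_simps)
  qed
qed

lemma sum_list_rotate: "sum_list (rotate i xs) = sum_list xs" for xs :: "nat list"
  by (metis append_take_drop_id rotate_drop_take add.commute sum_list_append)

lemma length_filter_rotate: "length (filter Q (rotate i xs)) = length (filter Q xs)"
  by (metis append_take_drop_id rotate_drop_take add.commute filter_append length_append)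

text \<open>
  The inverse of lengthening the last descent exists because the last block \<open>(a, b)\<close> of a good
  sequence of total height \<open>-1\<close> starts at a nonnegative height, so that \<open>b > a \<ge> 0\<close>.
\<close>
lemma card_lengthen_last:
  assumes "0 < k"
  shows "card {ps. length ps = k \<and> sum_list (map fst ps) = N \<and> sum_list (map snd ps) = N \<and>
            P (map fst ps) \<and> nonneg_prefixes block_height 0 ps} =
         card {ps. length ps = k \<and> sum_list (map fst ps) = N \<and> sum_list (map snd ps) = Suc N \<and>
            P (map fst ps) \<and> nonneg_prefixes block_height 0 (butlast ps)}"
    (is "card ?P = card ?G")
proof -
  let ?up = "\<lambda>ps. butlast ps @ [(fst (last ps), Suc (snd (last ps)))]"
  let ?down = "\<lambda>ps. butlast ps @ [(fst (last ps), snd (last ps) - 1)]"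
  have P: "\<exists>qs a b. ps = qs @ [(a, b)]" if "ps \<in> ?P" for ps
    using that assms by (cases ps rule: rev_cases) auto
  have G: "\<exists>qs a b. ps = qs @ [(a, Suc b)]" if ps: "ps \<in> ?G" for ps
  proof -
    obtain qs a b where qs: "ps = qs @ [(a, b)]"
      using ps assms by (cases ps rule: rev_cases) auto
    then have "0 \<le> sum_list (map block_height qs)"
      using ps nonneg_prefixes_final[of block_height 0 qs] by simp
    then have "b \<noteq> 0" using ps qs by (auto simp: sum_list_block_height)
    with qs show ?thesis by (metis not0_implies_Suc)
  qed
  have "bij_betw ?up ?P ?G"
  proof (rule bij_betw_byWitness[where f' = ?down])
    show "\<forall>ps\<in>?P. ?down (?up ps) = ps" using P by fastforce
    show "\<forall>ps\<in>?G. ?up (?down ps) = ps" using G by fastforce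
    show "?up ` ?P \<subseteq> ?G"
    proof (intro image_subsetI)
      fix ps assume ps: "ps \<in> ?P"
      with P obtain qs a b where "ps = qs @ [(a, b)]" by blast
      with ps show "?up ps \<in> ?G" by (simp add: nonneg_prefixes_append)
    qed
    show "?down ` ?G \<subseteq> ?P"
    proof (intro image_subsetI)
      fix ps assume ps: "ps \<in> ?G"
      with G obtain qs a b where qs: "ps = qs @ [(a, Suc b)]" by blast
      \<comment> \<open>The full sequence is the only prefix that the condition on
        \<open>butlast\<close> does not control.\<close>
      then have "sum_list (map block_height (qs @ [(a, b)])) = 0"
        using ps unfolding sum_list_block_height by simp
      with ps qs nonneg_prefixes_final[of block_height 0 qs] show "?down ps \<in> ?P"
        by (auto simp: nonneg_prefixes_append)
    qed
  qed
  then show ?thesis by (rule bij_betw_same_card)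
qed

theorem dyck_count_formula:
  assumes "0 < k" "k \<le> n"
  shows "k * dyck_count n k m = (n choose (k - 1)) * (k choose m) * compositions (n - k) m"
proof -
  define N where "N = n - k"
  have n: "n = N + k" using assms by (simp add: N_def)
  let ?S = "{ps. length ps = k \<and> sum_list (map fst ps) = N \<and> sum_list (map snd ps) = Suc N \<and>
      length (filter ((<) 0) (map fst ps)) = m}"
  let ?A = "{xs. length xs = k \<and> sum_list xs = N \<and> length (filter ((<) 0) xs) = m}"
  let ?B = "{xs. length xs = k \<and> sum_list xs = Suc N}"
  have "dyck_count n k m =
      card {ps. length ps = k \<and> sum_list (map fst ps) = N \<and> sum_list (map snd ps) = N \<and>
        length (filter ((<) 0) (map fst ps)) = m \<and> nonneg_prefixes block_height 0 ps}"
    by (simp add: dyck_count_eq_card_blocks n)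
  also have "\<dots> = card {ps \<in> ?S. nonneg_prefixes block_height 0 (butlast ps)}"
    using card_lengthen_last[OF assms(1), of N "\<lambda>xs. length (filter ((<) 0) xs) = m"]
    by (simp add: conj_assoc)
  finally have "k * dyck_count n k m = card ?S"
    by (subst cycle_lemma[where v = block_height and k = k])
      (auto simp: sum_list_block_height sum_list_rotate length_filter_rotate simp flip: rotate_map)
  also have "card ?S = card ?A * card ?B"
  proof -
    have "bij_betw (\<lambda>(xs, ys). zip xs ys) (?A \<times> ?B) ?S"
      by (rule bij_betw_byWitness[where f' = "\<lambda>ps. (map fst ps, map snd ps)"])
        (auto simp: zip_map_fst_snd simp del: length_filter_map)
    from bij_betw_same_card[OF this] show ?thesis by (simp only: card_cartesian_product)
  qed
  \<comment> \<open>Stars and bars for \<open>N + 1\<close> in \<open>k\<close> nonnegative parts: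
    \<open>n choose (N + 1)\<close>, where \<open>n - (N + 1) = k - 1\<close>.\<close>
  also have "card ?B = n choose (k - 1)"
    using assms card_length_sum_list[of k "Suc N"] binomial_symmetric[of "k - 1" n]
    by (simp add: n)
  finally show ?thesis by (simp add: card_lists_sum_positive N_def)
qed

section \<open>Translation into generalized Narayana numbers\<close>

lemma binom_nat: "binom (int a) (int b) = real (a choose b)"
  by (simp add: binom_def binomial_gbinomial)

text \<open>With \<open>r = j - 1\<close> and \<open>n = N + j - 1\<close> the second binomial is
  \<open>N - 1\<close> over \<open>m - 1\<close>, the number of compositions of \<open>N\<close>.
  The convention at (-1, -1) counts the empty composition of 0.\<close>

lemma gen_narayana_eq:
  assumes "0 < j"
  shows "gen_narayana (j - 1) (N + j - 1) m =
           real j / real (N + j) * real ((N + j) choose m) * real (compositions N m)"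
proof (cases "m \<le> N")
  case True
  have "binom (int N - 1) (int m - 1) = real (compositions N m)"
    using True by (cases N; cases m) (auto simp: binom_nat, auto simp: binom_def)
  moreover have "binom (int (N + j - 1) + 1) (int m) = real ((N + j) choose m)"
    using assms by (simp add: of_nat_diff flip: binom_nat)
  ultimately show ?thesis
    using assms True diff_le_mono[of j "N + j" 1]
    by (simp add: gen_narayana_def of_nat_diff algebra_simps)
next
  case False
  then have "compositions N m = 0" by (cases N; cases m) auto
  with False assms show ?thesis by (simp add: gen_narayana_def)
qed

text \<open>For \<open>m > 0\<close>, multiplying by \<open>m\<close> and absorbing it into the
  binomial gives \<open>a * b * (a - 1 choose m - 1) * (b - 1 choose m - 1)\<close>, symmetric in
  \<open>a\<close> and \<open>b\<close>. For \<open>m = 0\<close> both sides vanish.\<close>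

lemma compositions_absorb:
  assumes "0 < a" "0 < b"
  shows "b * (a choose m) * compositions b m = a * (b choose m) * compositions a m"
proof (cases m)
  case 0
  with assms show ?thesis by (cases a; cases b) auto
next
  case (Suc m')
  obtain a' b' where ab: "a = Suc a'" "b = Suc b'" using assms by (metis gr0_conv_Suc)
  have "Suc m' * (b * (a choose m) * compositions b m) =
      b * (Suc m' * (Suc a' choose Suc m')) * (b' choose m')"
    by (simp only: Suc ab compositions.simps ac_simps)
  also have "\<dots> = a * (Suc m' * (Suc b' choose Suc m')) * (a' choose m')"
    unfolding Suc_times_binomial by (simp only: ab ac_simps)
  also have "\<dots> = Suc m' * (a * (b choose m) * compositions a m)"
    by (simp only: Suc ab compositions.simps ac_simps)
  finally show ?thesis unfolding Suc_mult_cancel1 .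
qed

theorem theorem5p3:
  "(\<forall>j k m :: nat. 1 \<le> j \<and> 1 \<le> k \<longrightarrow>
      real (dyck_count (2 * k + j) k m) =
        1 / real j * real ((2 * k + j) choose (k - 1)) * gen_narayana (j - 1) (k + j - 1) m) \<and>
   (\<forall>j k m :: nat. 1 \<le> j \<and> j \<le> k \<longrightarrow>
      real (dyck_count (2 * k - j) k m) =
        1 / real j * real ((2 * k - j) choose (k - 1)) * gen_narayana (j - 1) (k - 1) m)"
proof (intro conjI allI impI)
  fix j k m :: nat assume jk: "1 \<le> j \<and> 1 \<le> k"
  define d where "d = dyck_count (2 * k + j) k m"
  define c where "c = (2 * k + j) choose (k - 1)"
  \<comment> \<open>The counting formula pairs \<open>k choose m\<close> with compositions of
    \<open>k + j\<close>, the Narayana number \<open>k + j choose m\<close> with compositions of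
    \<open>k\<close>. The factor \<open>k + j\<close> makes the exchange possible, and
    \<open>k\<close> cancels afterwards.\<close>
  have "k * ((k + j) * d) = (k + j) * (k * d)" by simp
  also have "k * d = c * (k choose m) * compositions (k + j) m"
    unfolding d_def c_def using jk by (subst dyck_count_formula) auto
  also have "(k + j) * (c * (k choose m) * compositions (k + j) m) =
      c * ((k + j) * (k choose m) * compositions (k + j) m)" by simp
  also have "\<dots> = c * (k * ((k + j) choose m) * compositions k m)"
    using jk by (subst compositions_absorb) auto
  also have "\<dots> = k * (c * ((k + j) choose m) * compositions k m)" by simp
  finally have "(k + j) * d = c * ((k + j) choose m) * compositions k m"
    using jk by simp
  then have "real (k + j) * real d = real c * real ((k + j) choose m) * real (compositions k m)"
    by (metis of_nat_mult)
  then show "real (dyck_count (2 * k + j) k m) =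
      1 / real j * real ((2 * k + j) choose (k - 1)) * gen_narayana (j - 1) (k + j - 1) m"
    using jk unfolding d_def[symmetric] c_def[symmetric]
    by (subst gen_narayana_eq) (auto simp: field_simps)
next
  fix j k m :: nat assume jk: "1 \<le> j \<and> j \<le> k"
  define d where "d = dyck_count (2 * k - j) k m"
  define c where "c = (2 * k - j) choose (k - 1)"
  have "k * d = c * (k choose m) * compositions (k - j) m"
    unfolding d_def c_def using jk by (subst dyck_count_formula) auto
  then have "real k * real d = real c * real (k choose m) * real (compositions (k - j) m)"
    by (metis of_nat_mult)
  then have "real d = real c * real (k choose m) * real (compositions (k - j) m) / real k"
    using jk by (simp add: field_simps)
  \<comment> \<open>Here \<open>n - k = k - j\<close>, so the counting formula already matches the
    Narayana number with \<open>N = k - j\<close>.\<close>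
  moreover have "gen_narayana (j - 1) (k - 1) m =
      real j / real k * real (k choose m) * real (compositions (k - j) m)"
    using gen_narayana_eq[of j "k - j" m] jk by simp
  ultimately show "real (dyck_count (2 * k - j) k m) =
      1 / real j * real ((2 * k - j) choose (k - 1)) * gen_narayana (j - 1) (k - 1) m"
    using jk unfolding d_def[symmetric] c_def[symmetric] by simp
qed

end
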